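(* Let $X\in\{\mathbf{S}^2\times\mathbf{R},\ \mathbf{H}^2\times\mathbf{R}\}$, let $P_1=(1,a,b,c)$ and $P_2=(1,d,e,f)$ be two proper points of $X$ and let $\lambda\in[0,\infty)$. Then the Apollonius surface $\mathcal{A}\mathcal{S}^X_{P_1P_2}(\lambda)$ has the following implicit equation: a point $(1,x,y,z)$ of $X$ lies on $\mathcal{A}\mathcal{S}^X_{P_1P_2}(\lambda)$ if and only if $$4\,\omega_X^2\!\left(\frac{ax \pm by \pm cz}{\sqrt{a^2 \pm b^2 \pm c^2}\sqrt{x^2 \pm y^2 \pm z^2}}\right)+\log^2\!\Big(\frac{a^2 \pm b^2 \pm c^2}{x^2 \pm y^2 \pm z^2}\Big)=\lambda^2\left[4\,\omega_X^2\!\left(\frac{dx \pm ey \pm fz}{\sqrt{d^2 \pm e^2 \pm f^2}\sqrt{x^2 \pm y^2 \pm z^2}}\right)+\log^2\!\Big(\frac{d^2 \pm e^2 \pm f^2}{x^2 \pm y^2 \pm z^2}\Big)\right],$$ where if $X=\mathbf{S}^2\times\mathbf{R}$ then all $\pm$ signs are $+$ and $\omega_X=\arccos$, and if $X=\mathbf{H}^2\times\mathbf{R}$ then all $\pm$ signs are $-$ and $\omega_X=\operatorname{arccosh}$.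
   Context: Models. Points are written in homogeneous coordinates $(1,x,y,z)$ and identified with $(x,y,z)\in\mathbf{R}^3$. $\mathbf{S}^2\times\mathbf{R}$ is $\{(x,y,z)\ne(0,0,0)\}$ with the Riemannian metric $ds^2=\frac{dx^2+dy^2+dz^2}{x^2+y^2+z^2}$; in coordinates $x=e^t\cos\phi\cos\theta$, $y=e^t\sin\phi\cos\theta$, $z=e^t\sin\theta$ this is $ds^2=dt^2+\cos^2\theta\,d\phi^2+d\theta^2$. $\mathbf{H}^2\times\mathbf{R}$ is $\{(x,y,z): x>0,\ x^2-y^2-z^2>0\}$ with the Riemannian metric which in coordinates $x=e^t\cosh r$, $y=e^t\sinh r\cos\alpha$, $z=e^t\sinh r\sin\alpha$ ($r\ge 0$, $-\pi<\alpha\le\pi$, $t\in\mathbf{R}$) is $ds^2=dt^2+dr^2+\sinh^2 r\,d\alpha^2$. Proper points are the points of these models. $d^X(P,Q)$ denotes the geodesic distance, i.e. the arc length of the (shortest) geodesic curve from $P$ to $Q$. Apollonius surface: for two points $P_1,P_2\in X$ and $\lambda\in[0,\infty)$, $\mathcal{A}\mathcal{S}^X_{P_1P_2}(\lambda)$ is the set of all points $P'\in X$ with $d^X(P_1,P')=\lambda\cdot d^X(P',P_2)$; in particular $\mathcal{A}\mathcal{S}^X_{P_1P_2}(0)=\{P_1\}$. *)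

theory Defs
  imports "HOL-Analysis.Analysis"
begin

text \<open>
  Points \<open>(1,x,y,z)\<close> in homogeneous coordinates are identified with \<open>(x,y,z)\<close>.
\<close>

type_synonym point = "real \<times> real \<times> real"

datatype geometry = S2xR | H2xR

fun model :: "geometry \<Rightarrow> point set" where
  "model S2xR = {(x, y, z). (x, y, z) \<noteq> (0, 0, 0)}"
| "model H2xR = {(x, y, z). x > 0 \<and> x\<^sup>2 - y\<^sup>2 - z\<^sup>2 > 0}"

text \<open>
  \<open>line_element X p v\<close> is the Riemannian quadratic form \<open>ds\<^sup>2\<close> at \<open>p\<close>, evaluated on the tangent
  vector \<open>v\<close>.  For \<open>H2xR\<close> the metric is prescribed in the coordinates \<open>(t, r, \<alpha>)\<close> as
  \<open>dt\<^sup>2 + dr\<^sup>2 + sinh\<^sup>2 r d\<alpha>\<^sup>2\<close>.  These are singular on the axis \<open>r = 0\<close>, so the form is written out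
  in Cartesian coordinates: with \<open>\<langle>\<cdot>,\<cdot>\<rangle>\<close> the form of signature \<open>(+,-,-)\<close> and \<open>p = e\<^sup>t n\<close>,
  \<open>\<langle>n,n\<rangle> = 1\<close>, one has \<open>dt = \<langle>p,dp\<rangle> / \<langle>p,p\<rangle>\<close> and
  \<open>\<langle>dp,dp\<rangle> / \<langle>p,p\<rangle> = dt\<^sup>2 - (dr\<^sup>2 + sinh\<^sup>2 r d\<alpha>\<^sup>2)\<close>.  The lemma \<open>line_element_H2xR_chart\<close> below
  confirms that this is the prescribed metric.
\<close>

fun line_element :: "geometry \<Rightarrow> point \<Rightarrow> point \<Rightarrow> real" where
  "line_element S2xR (x, y, z) (dx, dy, dz) = (dx\<^sup>2 + dy\<^sup>2 + dz\<^sup>2) / (x\<^sup>2 + y\<^sup>2 + z\<^sup>2)"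
| "line_element H2xR (x, y, z) (dx, dy, dz) =
     2 * ((x * dx - y * dy - z * dz) / (x\<^sup>2 - y\<^sup>2 - z\<^sup>2))\<^sup>2
     - (dx\<^sup>2 - dy\<^sup>2 - dz\<^sup>2) / (x\<^sup>2 - y\<^sup>2 - z\<^sup>2)"

fun chart_S2xR :: "real \<times> real \<times> real \<Rightarrow> point" where
  "chart_S2xR (t, \<phi>, \<theta>) = (exp t * cos \<phi> * cos \<theta>, exp t * sin \<phi> * cos \<theta>, exp t * sin \<theta>)"

fun chart_H2xR :: "real \<times> real \<times> real \<Rightarrow> point" where
  "chart_H2xR (t, r, \<alpha>) = (exp t * cosh r, exp t * sinh r * cos \<alpha>, exp t * sinh r * sin \<alpha>)"

lemma range_chart_H2xR: "chart_H2xR ` {(t, r, \<alpha>). r \<ge> 0 \<and> - pi < \<alpha> \<and> \<alpha> \<le> pi} = model H2xR"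
proof (intro set_eqI iffI)
  fix p assume "p \<in> chart_H2xR ` {(t, r, \<alpha>). r \<ge> 0 \<and> - pi < \<alpha> \<and> \<alpha> \<le> pi}"
  then obtain t r \<alpha> where p: "p = chart_H2xR (t, r, \<alpha>)" by auto
  have "(exp t * cosh r)\<^sup>2 - (exp t * sinh r * cos \<alpha>)\<^sup>2 - (exp t * sinh r * sin \<alpha>)\<^sup>2 = (exp t)\<^sup>2"
    using cosh_square_eq[of r] sin_cos_squared_add[of \<alpha>] by algebra
  moreover have "(exp t)\<^sup>2 > 0" by simp
  ultimately have "(exp t * cosh r)\<^sup>2 - (exp t * sinh r * cos \<alpha>)\<^sup>2 - (exp t * sinh r * sin \<alpha>)\<^sup>2 > 0"
    by (simp only:)
  then show "p \<in> model H2xR" by (simp add: p)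
next
  fix p assume pm: "p \<in> model H2xR"
  obtain x y z where p: "p = (x, y, z)" by (cases p)
  have x: "x > 0" and q: "x\<^sup>2 - y\<^sup>2 - z\<^sup>2 > 0" using pm p by auto
  define m where "m = sqrt (x\<^sup>2 - y\<^sup>2 - z\<^sup>2)"
  have m: "m > 0" "m\<^sup>2 = x\<^sup>2 - y\<^sup>2 - z\<^sup>2" using q by (auto simp: m_def)
  define w where "w = Complex y z"
  have w: "(cmod w)\<^sup>2 = y\<^sup>2 + z\<^sup>2" by (simp add: w_def cmod_power2)
  define r where "r = arsinh (cmod w / m)"
  have s: "sinh r = cmod w / m" by (simp add: r_def)
  have r: "r \<ge> 0" by (metis s m(1) divide_nonneg_pos norm_ge_zero sinh_real_nonneg_iff)
  have "(cosh r)\<^sup>2 = (x / m)\<^sup>2"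
    using m w by (simp add: cosh_square_eq s power_divide field_simps)
  then have c: "cosh r = x / m" using x m(1) by (simp add: power2_eq_iff_nonneg)
  have y: "cmod w * cos (Arg w) = y" and z: "cmod w * sin (Arg w) = z"
    using rcis_cmod_Arg[of w] by (simp_all add: w_def rcis_def cis.ctr complex_eq_iff)
  have "p = chart_H2xR (ln m, r, Arg w)"
    using m(1) y z by (simp add: p c s)
  moreover have "- pi < Arg w \<and> Arg w \<le> pi" using Arg_bounded by auto
  ultimately show "p \<in> chart_H2xR ` {(t, r, \<alpha>). r \<ge> 0 \<and> - pi < \<alpha> \<and> \<alpha> \<le> pi}"
    using r by blast
qed

lemma line_element_S2xR_chart:
  assumes "(t has_real_derivative t') (at s)" "(\<phi> has_real_derivative \<phi>') (at s)"
    "(\<theta> has_real_derivative \<theta>') (at s)"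
  shows "\<exists>v. ((\<lambda>s. chart_S2xR (t s, \<phi> s, \<theta> s)) has_vector_derivative v) (at s) \<and>
    line_element S2xR (chart_S2xR (t s, \<phi> s, \<theta> s)) v = t'\<^sup>2 + (cos (\<theta> s))\<^sup>2 * \<phi>'\<^sup>2 + \<theta>'\<^sup>2"
proof -
  define E c n d m where "E = exp (t s)" and "c = cos (\<phi> s)" and "n = sin (\<phi> s)"
    and "d = cos (\<theta> s)" and "m = sin (\<theta> s)"
  have E: "E > 0" and cn: "c\<^sup>2 = 1 - n\<^sup>2" and dm: "d\<^sup>2 = 1 - m\<^sup>2"
    by (simp_all add: E_def c_def n_def d_def m_def cos_squared_eq)
  define v where "v = (E * (t' * c * d - \<phi>' * n * d - \<theta>' * c * m),
     E * (t' * n * d + \<phi>' * c * d - \<theta>' * n * m), E * (t' * m + \<theta>' * d))"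
  have "((\<lambda>s. chart_S2xR (t s, \<phi> s, \<theta> s)) has_vector_derivative v) (at s)"
    unfolding chart_S2xR.simps v_def E_def c_def n_def d_def m_def
    by (intro has_vector_derivative_Pair; unfold has_real_derivative_iff_has_vector_derivative[symmetric])
       (rule derivative_eq_intros assms refl | simp add: algebra_simps)+
  moreover have "line_element S2xR (chart_S2xR (t s, \<phi> s, \<theta> s)) v = t'\<^sup>2 + d\<^sup>2 * \<phi>'\<^sup>2 + \<theta>'\<^sup>2"
  proof -
    have q: "(E * c * d)\<^sup>2 + (E * n * d)\<^sup>2 + (E * m)\<^sup>2 = E\<^sup>2"
      using cn dm by algebra
    have b: "(E * (t' * c * d - \<phi>' * n * d - \<theta>' * c * m))\<^sup>2
      + (E * (t' * n * d + \<phi>' * c * d - \<theta>' * n * m))\<^sup>2 + (E * (t' * m + \<theta>' * d))\<^sup>2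
      = E\<^sup>2 * (t'\<^sup>2 + d\<^sup>2 * \<phi>'\<^sup>2 + \<theta>'\<^sup>2)"
      using cn dm by algebra
    show ?thesis
      unfolding chart_S2xR.simps v_def line_element.simps E_def[symmetric] c_def[symmetric]
        n_def[symmetric] d_def[symmetric] m_def[symmetric] q b
      using E by simp
  qed
  ultimately show ?thesis unfolding d_def by blast
qed

lemma line_element_H2xR_chart:
  assumes "(t has_real_derivative t') (at s)" "(r has_real_derivative r') (at s)"
    "(\<alpha> has_real_derivative \<alpha>') (at s)"
  shows "\<exists>v. ((\<lambda>s. chart_H2xR (t s, r s, \<alpha> s)) has_vector_derivative v) (at s) \<and>
    line_element H2xR (chart_H2xR (t s, r s, \<alpha> s)) v = t'\<^sup>2 + r'\<^sup>2 + (sinh (r s))\<^sup>2 * \<alpha>'\<^sup>2"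
proof -
  define E C S c n where "E = exp (t s)" and "C = cosh (r s)" and "S = sinh (r s)"
    and "c = cos (\<alpha> s)" and "n = sin (\<alpha> s)"
  have E: "E > 0" and CS: "C\<^sup>2 = S\<^sup>2 + 1" and cn: "c\<^sup>2 = 1 - n\<^sup>2"
    by (simp_all add: E_def C_def S_def c_def n_def cosh_square_eq cos_squared_eq)
  define v where "v = (E * (t' * C + r' * S), E * (t' * S * c + r' * C * c - \<alpha>' * S * n),
     E * (t' * S * n + r' * C * n + \<alpha>' * S * c))"
  have "((\<lambda>s. chart_H2xR (t s, r s, \<alpha> s)) has_vector_derivative v) (at s)"
    unfolding chart_H2xR.simps v_def E_def C_def S_def c_def n_def
    by (intro has_vector_derivative_Pair; unfold has_real_derivative_iff_has_vector_derivative[symmetric])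
       (rule derivative_eq_intros assms refl | simp add: algebra_simps)+
  moreover have "line_element H2xR (chart_H2xR (t s, r s, \<alpha> s)) v = t'\<^sup>2 + r'\<^sup>2 + S\<^sup>2 * \<alpha>'\<^sup>2"
  proof -
    have q: "(E * C)\<^sup>2 - (E * S * c)\<^sup>2 - (E * S * n)\<^sup>2 = E\<^sup>2"
      using CS cn by algebra
    have b: "E * C * (E * (t' * C + r' * S)) - E * S * c * (E * (t' * S * c + r' * C * c - \<alpha>' * S * n))
      - E * S * n * (E * (t' * S * n + r' * C * n + \<alpha>' * S * c)) = E\<^sup>2 * t'"
      using CS cn by algebra
    have d: "(E * (t' * C + r' * S))\<^sup>2 - (E * (t' * S * c + r' * C * c - \<alpha>' * S * n))\<^sup>2
      - (E * (t' * S * n + r' * C * n + \<alpha>' * S * c))\<^sup>2 = E\<^sup>2 * (t'\<^sup>2 - (r'\<^sup>2 + S\<^sup>2 * \<alpha>'\<^sup>2))"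
      using CS cn by algebra
    show ?thesis
      unfolding chart_H2xR.simps v_def line_element.simps E_def[symmetric] C_def[symmetric]
        S_def[symmetric] c_def[symmetric] n_def[symmetric] q b d
      using E by simp
  qed
  ultimately show ?thesis unfolding S_def by blast
qed

text \<open>
  Curves on a parameter interval \<open>{s..u}\<close>.  Differentiability up to the end points (two-sided, i.e.
  for a \<open>C\<^sup>1\<close> extension) guarantees that the speed is continuous, so the integral below exists.
\<close>

definition C1_curve :: "geometry \<Rightarrow> (real \<Rightarrow> point) \<Rightarrow> real \<Rightarrow> real \<Rightarrow> bool" where
  "C1_curve X \<gamma> s u \<longleftrightarrow> \<gamma> C1_differentiable_on {s..u} \<and> \<gamma> ` {s..u} \<subseteq> model X"

definition arc_length :: "geometry \<Rightarrow> (real \<Rightarrow> point) \<Rightarrow> real \<Rightarrow> real \<Rightarrow> real" where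
  "arc_length X \<gamma> s u =
     integral {s..u} (\<lambda>\<tau>. sqrt (line_element X (\<gamma> \<tau>) (vector_derivative \<gamma> (at \<tau>))))"

text \<open>
  A geodesic curve has minimal arc length between any two of its points with sufficiently close
  parameters.  No particular parametrization is prescribed, and constant curves are included, so
  that every point has distance \<open>0\<close> from itself.
\<close>

definition geodesic_curve :: "geometry \<Rightarrow> point \<Rightarrow> point \<Rightarrow> (real \<Rightarrow> point) \<Rightarrow> bool" where
  "geodesic_curve X P Q \<gamma> \<longleftrightarrow> C1_curve X \<gamma> 0 1 \<and> \<gamma> 0 = P \<and> \<gamma> 1 = Q \<and>
     (\<exists>\<epsilon>>0. \<forall>s u. 0 \<le> s \<and> s < u \<and> u \<le> 1 \<and> u - s < \<epsilon> \<longrightarrow>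
        (\<forall>\<delta>. C1_curve X \<delta> s u \<and> \<delta> s = \<gamma> s \<and> \<delta> u = \<gamma> u \<longrightarrow>
             arc_length X \<gamma> s u \<le> arc_length X \<delta> s u))"

text \<open>
  The length of the shortest geodesic curve; the infimum is a minimum when a shortest one exists.
\<close>

definition geodesic_dist :: "geometry \<Rightarrow> point \<Rightarrow> point \<Rightarrow> real" where
  "geodesic_dist X P Q = Inf {arc_length X \<gamma> 0 1 |\<gamma>. geodesic_curve X P Q \<gamma>}"

definition apollonius_surface :: "geometry \<Rightarrow> point \<Rightarrow> point \<Rightarrow> real \<Rightarrow> point set" where
  "apollonius_surface X P1 P2 l =
     {P \<in> model X. geodesic_dist X P1 P = l * geodesic_dist X P P2}"

text \<open>
  The sign of the paper's \<open>\<plusminus>\<close>.  It associates to the left: \<open>a \<plusminus> b \<plusminus> c\<close> is \<open>a - b - c\<close> for \<open>H2xR\<close>.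
\<close>

fun pm :: "real \<Rightarrow> geometry \<Rightarrow> real \<Rightarrow> real" (\<open>(_ \<plusminus>\<^bsub>_\<^esub> _)\<close> [65, 0, 66] 65) where
  "u \<plusminus>\<^bsub>S2xR\<^esub> v = u + v"
| "u \<plusminus>\<^bsub>H2xR\<^esub> v = u - v"

fun omega :: "geometry \<Rightarrow> real \<Rightarrow> real" where
  "omega S2xR = arccos"
| "omega H2xR = arcosh"

end

theory Submission
  imports Defs
begin

text \<open>
  Both models are cones \<open>p = e\<^sup>t n\<close> over the unit sphere of a quadratic form, and the metric is the
  product \<open>dt\<^sup>2 + d\<sigma>\<^sup>2\<close> with \<open>d\<sigma>\<close> the metric of that sphere.  Hence the geodesic distance is
  \<open>sqrt (\<omega>\<^sup>2 + \<tau>\<^sup>2)\<close> with \<open>\<omega>\<close> the angle and \<open>\<tau>\<close> the difference of the \<open>t\<close>-coordinates.  It is attained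
  by the curve moving at constant speed along a great circle and along \<open>t\<close>.  That no curve starting at \<open>P\<close>
  is shorter follows by calibration: with \<open>f\<close> the angle to \<open>P\<close>, the function \<open>\<omega> f + \<tau> t\<close> has gradient
  of norm at most \<open>sqrt (\<omega>\<^sup>2 + \<tau>\<^sup>2)\<close>, which comes down to the nonnegativity of a Gram determinant.
  Since \<open>f\<close> is not differentiable at \<open>P\<close> (nor, for \<open>S2xR\<close>, at its antipode), \<open>arccos x\<close> is replaced by
  \<open>arccos (k x)\<close> with \<open>k < 1\<close>, respectively \<open>arcosh x\<close> by \<open>arcosh (k x)\<close> with \<open>k > 1\<close>, and \<open>k\<close> tends to
  \<open>1\<close>.  This only decreases the norm of the gradient.
\<close>

section \<open>The quadratic forms of the two cones and their Gram determinants\<close>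

fun sg :: "geometry \<Rightarrow> real" where
  "sg S2xR = 1"
| "sg H2xR = - 1"

text \<open>This is the Euclidean scalar product for \<open>S2xR\<close> and the Lorentzian one of
  signature \<open>(+,-,-)\<close> for \<open>H2xR\<close>. The sign \<open>sg\<close> is the
  curvature of the two-dimensional factor; carrying it along lets most arguments treat both
  geometries at once.\<close>

fun form :: "geometry \<Rightarrow> point \<Rightarrow> point \<Rightarrow> real" where
  "form X (x, y, z) (x', y', z') = x * x' + sg X * (y * y' + z * z')"

lemma form_S2xR: "form S2xR (x, y, z) (x', y', z') = x * x' + y * y' + z * z'"
  and form_H2xR: "form H2xR (x, y, z) (x', y', z') = x * x' - y * y' - z * z'"
  by simp_all

lemma sg_sq [simp]: "sg X * sg X = 1"
  by (cases X) auto

lemma form_commute: "form X P Q = form X Q P"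
  by (cases P; cases Q) (simp add: algebra_simps)

lemma bounded_bilinear_form: "bounded_bilinear (form X)"
proof -
  have "bilinear (form X)"
    unfolding bilinear_def by (auto intro!: linearI simp: algebra_simps)
  then show ?thesis by (simp add: bilinear_conv_bounded_bilinear)
qed

interpretation form: bounded_bilinear "form X" for X
  by (rule bounded_bilinear_form)

lemma form_self_pos:
  assumes "P \<in> model X"
  shows "form X P P > 0"
proof (cases X)
  case S2xR
  then show ?thesis
    using assms by (cases P) (auto simp: power2_eq_square[symmetric] add_pos_nonneg add_nonneg_pos)
next
  case H2xR
  then show ?thesis
    using assms by (cases P) (auto simp: power2_eq_square)
qed

text \<open>Split \<open>V\<close> into a multiple of \<open>P\<close> and a part orthogonal to
  \<open>P\<close>. The first contributes \<open>form X P V / form X P P\<close>, the value of dt on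
  \<open>V\<close>. On the second, \<open>form\<close> is definite with sign \<open>sg X\<close>, so
  the factor \<open>sg X\<close> turns it into the metric of the unit sphere.\<close>

lemma line_element_form:
  "line_element X P V = (form X P V / form X P P)\<^sup>2
     + sg X * (form X V V / form X P P - (form X P V / form X P P)\<^sup>2)"
proof (cases X)
  case S2xR
  then show ?thesis
    by (cases P; cases V) (simp add: power2_eq_square form_S2xR del: form.simps)
next
  case H2xR
  then show ?thesis
    by (cases P; cases V) (simp add: power2_eq_square form_H2xR del: form.simps)
qed

text \<open>By Sylvester's determinant identity the left side is \<open>form X G G\<close> times the
  Gram determinant of \<open>P\<close>, \<open>G\<close>, \<open>V\<close>. That one is the squared
  determinant of the three vectors times the determinant of the form, which is
  \<open>sg X * sg X = 1\<close>.\<close>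

lemma gram_identity:
  "(form X G G * form X P P - (form X P G)\<^sup>2) * (form X G G * form X V V - (form X G V)\<^sup>2)
     - (form X G G * form X P V - form X P G * form X G V)\<^sup>2
   = form X G G * (case (P, G, V) of ((p1, p2, p3), (g1, g2, g3), (v1, v2, v3)) \<Rightarrow>
       p1 * (g2 * v3 - g3 * v2) - p2 * (g1 * v3 - g3 * v1) + p3 * (g1 * v2 - g2 * v1))\<^sup>2"
proof -
  obtain p1 p2 p3 g1 g2 g3 v1 v2 v3
    where PGV: "P = (p1, p2, p3)" "G = (g1, g2, g3)" "V = (v1, v2, v3)"
    by (cases P; cases G; cases V) auto
  have det: "form X G G * form X P P * form X V V + 2 * form X P G * form X P V * form X G V
      - form X G G * (form X P V)\<^sup>2 - form X P P * (form X G V)\<^sup>2 - form X V V * (form X P G)\<^sup>2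
    = (p1 * (g2 * v3 - g3 * v2) - p2 * (g1 * v3 - g3 * v1) + p3 * (g1 * v2 - g2 * v1))\<^sup>2"
  proof (cases X)
    case S2xR
    show ?thesis
      unfolding PGV S2xR form_S2xR by (simp add: power2_eq_square algebra_simps)
  next
    case H2xR
    show ?thesis
      unfolding PGV H2xR form_H2xR by (simp add: power2_eq_square algebra_simps)
  qed
  show ?thesis
    unfolding PGV prod.case det[unfolded PGV, symmetric] by algebra
qed

text \<open>Up to powers of \<open>form X G G\<close> this is the Cauchy-Schwarz inequality for the
  parts of \<open>P\<close> and \<open>V\<close> orthogonal to \<open>G\<close>. There
  \<open>form\<close> is definite, so the inequality has the same direction in both
  geometries.\<close>

lemma gram_inequality:
  assumes "G \<in> model X"
  shows "(form X G G * form X P V - form X P G * form X G V)\<^sup>2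
    \<le> (form X G G * form X P P - (form X P G)\<^sup>2) * (form X G G * form X V V - (form X G V)\<^sup>2)"
proof -
  have "0 \<le> (form X G G * form X P P - (form X P G)\<^sup>2) * (form X G G * form X V V - (form X G V)\<^sup>2)
     - (form X G G * form X P V - form X P G * form X G V)\<^sup>2"
    unfolding gram_identity using form_self_pos[OF assms] by (intro mult_nonneg_nonneg) simp_all
  then show ?thesis by (simp only: diff_ge_0_iff_ge)
qed

section \<open>The argument of the angle function and its range\<close>

definition ratio :: "geometry \<Rightarrow> point \<Rightarrow> point \<Rightarrow> real" where
  "ratio X P Q = form X P Q / (sqrt (form X P P) * sqrt (form X Q Q))"

fun ratio_dom :: "geometry \<Rightarrow> real set" where
  "ratio_dom S2xR = {-1..1}"
| "ratio_dom H2xR = {1..}"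

text \<open>The reversed Cauchy-Schwarz inequality for vectors of the same cone; the positive first
  coordinates decide the sign.\<close>

lemma form_sqrt_form_le_H2xR:
  assumes "P \<in> model H2xR" "Q \<in> model H2xR"
  shows "sqrt (form H2xR P P) * sqrt (form H2xR Q Q) \<le> form H2xR P Q"
proof -
  obtain a b c x y z where P: "P = (a, b, c)" and Q: "Q = (x, y, z)" by (cases P; cases Q) auto
  have pos: "a > 0" "x > 0" "a\<^sup>2 - b\<^sup>2 - c\<^sup>2 > 0" "x\<^sup>2 - y\<^sup>2 - z\<^sup>2 > 0" using assms P Q by auto
  define m n where "m = sqrt (a\<^sup>2 - b\<^sup>2 - c\<^sup>2)" and "n = sqrt (x\<^sup>2 - y\<^sup>2 - z\<^sup>2)"
  have m: "m > 0" "m\<^sup>2 = a\<^sup>2 - b\<^sup>2 - c\<^sup>2" and n: "n > 0" "n\<^sup>2 = x\<^sup>2 - y\<^sup>2 - z\<^sup>2"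
    using pos by (auto simp: m_def n_def)
  have "m\<^sup>2 \<le> a\<^sup>2" "n\<^sup>2 \<le> x\<^sup>2" unfolding m(2) n(2) by simp_all
  then have "m \<le> a" "n \<le> x" using pos power2_le_imp_le less_imp_le by blast+
  then have le: "m * n \<le> a * x" using m(1) n(1) pos(1) by (intro mult_mono) simp_all
  \<comment> \<open>Lagrange's identity for \<open>(b, c)\<close> and \<open>(y, z)\<close>, with
    the squared norms replaced by \<open>a\<^sup>2 - m\<^sup>2\<close> and
    \<open>x\<^sup>2 - n\<^sup>2\<close>. Since \<open>le\<close> makes \<open>a * x - m * n\<close>
    nonnegative, the squares can then be dropped.\<close>
  have "(a * x - m * n)\<^sup>2 - (b * y + c * z)\<^sup>2 = (b * z - c * y)\<^sup>2 + (a * n - x * m)\<^sup>2"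
    using m(2) n(2) by algebra
  then have "(b * y + c * z)\<^sup>2 \<le> (a * x - m * n)\<^sup>2"
    using sum_power2_ge_zero[of "b * z - c * y" "a * n - x * m"] by linarith
  then have "b * y + c * z \<le> a * x - m * n"
    by (rule power2_le_imp_le) (use le in linarith)
  then show ?thesis by (simp add: P Q m_def n_def power2_eq_square form_H2xR del: form.simps)
qed

lemma ratio_in_dom:
  assumes "P \<in> model X" "Q \<in> model X"
  shows "ratio X P Q \<in> ratio_dom X"
proof (cases X)
  case S2xR
  obtain a b c x y z where P: "P = (a, b, c)" and Q: "Q = (x, y, z)" by (cases P; cases Q) auto
  have pos: "form X P P > 0" "form X Q Q > 0" using assms form_self_pos by auto
  have "form X P P * form X Q Q - (form X P Q)\<^sup>2
      = (a * y - b * x)\<^sup>2 + (a * z - c * x)\<^sup>2 + (b * z - c * y)\<^sup>2"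
    unfolding P Q S2xR form_S2xR by algebra
  then have "(form X P Q)\<^sup>2 \<le> form X P P * form X Q Q"
    by (smt (verit) zero_le_power2)
  then have "\<bar>form X P Q\<bar> \<le> sqrt (form X P P) * sqrt (form X Q Q)"
    by (metis real_sqrt_abs real_sqrt_le_mono real_sqrt_mult)
  moreover have "sqrt (form X P P) * sqrt (form X Q Q) > 0" using pos by simp
  ultimately have "\<bar>ratio X P Q\<bar> \<le> 1"
    by (simp add: ratio_def)
  then show ?thesis by (auto simp: S2xR)
next
  case H2xR
  have "form X P P > 0" "form X Q Q > 0" using assms form_self_pos by auto
  then show ?thesis
    using form_sqrt_form_le_H2xR[of P Q] assms by (simp add: H2xR ratio_def)
qed

text \<open>The Pythagorean distance of the product metric. As \<open>form X P P\<close> is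
  \<open>exp (2 * t)\<close>, half the logarithm is the difference of the t-coordinates.\<close>

definition pdist :: "geometry \<Rightarrow> point \<Rightarrow> point \<Rightarrow> real" where
  "pdist X P Q = sqrt ((omega X (ratio X P Q))\<^sup>2 + (ln (form X Q Q / form X P P) / 2)\<^sup>2)"

section \<open>Derivatives along a curve and the gradient bound\<close>

lemma omega_has_derivative:
  assumes "y \<in> ratio_dom X" "sg X * (1 - y\<^sup>2) > 0"
  shows "(omega X has_real_derivative (- sg X / sqrt (sg X * (1 - y\<^sup>2)))) (at y)"
proof (cases X)
  case S2xR
  then have "y\<^sup>2 < 1\<^sup>2" using assms by simp
  then have "\<bar>y\<bar> < 1" using power2_less_imp_less[of "\<bar>y\<bar>" 1] by simp
  then have "-1 < y" "y < 1" by auto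
  then show ?thesis
    using DERIV_arccos[of y] by (simp add: S2xR field_simps)
next
  case H2xR
  then have "y \<ge> 1" "y \<noteq> 1" using assms by auto
  then show ?thesis
    using arcosh_real_has_field_derivative[of y UNIV] by (simp add: H2xR)
qed

lemma ratio_has_derivative:
  fixes \<gamma> :: "real \<Rightarrow> point"
  assumes "(\<gamma> has_vector_derivative V) (at \<tau>)" "P \<in> model X" "\<gamma> \<tau> \<in> model X"
  shows "((\<lambda>\<tau>. ratio X P (\<gamma> \<tau>)) has_real_derivative
     (form X (\<gamma> \<tau>) (\<gamma> \<tau>) * form X P V - form X P (\<gamma> \<tau>) * form X (\<gamma> \<tau>) V)
       / (form X (\<gamma> \<tau>) (\<gamma> \<tau>) * (sqrt (form X P P) * sqrt (form X (\<gamma> \<tau>) (\<gamma> \<tau>))))) (at \<tau>)"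
    and "((\<lambda>\<tau>. ln (form X (\<gamma> \<tau>) (\<gamma> \<tau>)) / 2) has_real_derivative
     form X (\<gamma> \<tau>) V / form X (\<gamma> \<tau>) (\<gamma> \<tau>)) (at \<tau>)"
proof -
  have pos: "form X P P > 0" "form X (\<gamma> \<tau>) (\<gamma> \<tau>) > 0" using assms form_self_pos by auto
  have g: "((\<lambda>\<tau>. form X P (\<gamma> \<tau>)) has_real_derivative form X P V) (at \<tau>)"
    using form.has_vector_derivative[OF has_vector_derivative_const assms(1)]
    by (simp add: has_real_derivative_iff_has_vector_derivative form.zero_left)
  have N: "((\<lambda>\<tau>. form X (\<gamma> \<tau>) (\<gamma> \<tau>)) has_real_derivative 2 * form X (\<gamma> \<tau>) V) (at \<tau>)"
    using form.has_vector_derivative[where X = X, OF assms(1) assms(1)]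
    by (simp add: has_real_derivative_iff_has_vector_derivative form_commute[of X V])
  show "((\<lambda>\<tau>. ln (form X (\<gamma> \<tau>) (\<gamma> \<tau>)) / 2) has_real_derivative
     form X (\<gamma> \<tau>) V / form X (\<gamma> \<tau>) (\<gamma> \<tau>)) (at \<tau>)"
    using pos by (auto intro!: derivative_eq_intros N)
  define m n where "m = sqrt (form X P P)" and "n = sqrt (form X (\<gamma> \<tau>) (\<gamma> \<tau>))"
  have mn: "m > 0" "n > 0" "form X (\<gamma> \<tau>) (\<gamma> \<tau>) = n\<^sup>2" using pos by (auto simp: m_def n_def)
  have S: "((\<lambda>\<tau>. sqrt (form X (\<gamma> \<tau>) (\<gamma> \<tau>))) has_real_derivative form X (\<gamma> \<tau>) V / n) (at \<tau>)"
    using pos by (auto intro!: derivative_eq_intros N simp: n_def divide_simps)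
  have "((\<lambda>\<tau>. form X P (\<gamma> \<tau>) / (m * sqrt (form X (\<gamma> \<tau>) (\<gamma> \<tau>)))) has_real_derivative
     (form X P V * (m * n) - form X P (\<gamma> \<tau>) * (m * (form X (\<gamma> \<tau>) V / n))) / ((m * n) * (m * n))) (at \<tau>)"
    using mn(1,2) unfolding n_def
    by (intro DERIV_divide g DERIV_cmult S[unfolded n_def]) auto
  moreover have "(form X P V * (m * n) - form X P (\<gamma> \<tau>) * (m * (form X (\<gamma> \<tau>) V / n))) / ((m * n) * (m * n))
    = (n\<^sup>2 * form X P V - form X P (\<gamma> \<tau>) * form X (\<gamma> \<tau>) V) / (n\<^sup>2 * (m * n))"
    using mn(1,2) by (simp add: divide_simps power2_eq_square) (simp add: algebra_simps)
  ultimately show "((\<lambda>\<tau>. ratio X P (\<gamma> \<tau>)) has_real_derivative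
     (form X (\<gamma> \<tau>) (\<gamma> \<tau>) * form X P V - form X P (\<gamma> \<tau>) * form X (\<gamma> \<tau>) V)
       / (form X (\<gamma> \<tau>) (\<gamma> \<tau>) * (sqrt (form X P P) * sqrt (form X (\<gamma> \<tau>) (\<gamma> \<tau>))))) (at \<tau>)"
    unfolding ratio_def m_def[symmetric] n_def[symmetric] unfolding mn(3) by (simp only:)
qed

text \<open>This is \<open>gram_inequality\<close> after normalisation. The second factor is the
  orthogonal part of the line element; the first is the one that the derivative of
  \<open>omega\<close> cancels.\<close>

lemma ratio_derivative_bound:
  assumes "P \<in> model X" "G \<in> model X"
  shows "((form X G G * form X P V - form X P G * form X G V)
       / (form X G G * (sqrt (form X P P) * sqrt (form X G G))))\<^sup>2
    \<le> (sg X * (1 - (ratio X P G)\<^sup>2)) * (sg X * (form X V V / form X G G - (form X G V / form X G G)\<^sup>2))"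
proof -
  have pos: "form X P P > 0" "form X G G > 0" using assms form_self_pos by auto
  have "((form X G G * form X P V - form X P G * form X G V)
       / (form X G G * (sqrt (form X P P) * sqrt (form X G G))))\<^sup>2
     = (form X G G * form X P V - form X P G * form X G V)\<^sup>2 / ((form X G G)\<^sup>2 * (form X P P * form X G G))"
    using pos by (simp add: power_divide power_mult_distrib)
  also have "\<dots> \<le> (form X G G * form X P P - (form X P G)\<^sup>2) * (form X G G * form X V V - (form X G V)\<^sup>2)
      / ((form X G G)\<^sup>2 * (form X P P * form X G G))"
    using pos by (intro divide_right_mono gram_inequality assms) auto
  also have "\<dots> = (1 - (ratio X P G)\<^sup>2) * (form X V V / form X G G - (form X G V / form X G G)\<^sup>2)"
    using pos by (simp add: ratio_def power_divide power_mult_distrib divide_simps)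
      (simp add: algebra_simps power2_eq_square)
  \<comment> \<open>One sign goes to each factor, which makes both of them nonnegative.\<close>
  also have "\<dots> = (sg X * sg X) * \<dots>" by simp
  finally show ?thesis by (simp only: mult_ac)
qed

lemma orthogonal_part_nonneg:
  assumes "G \<in> model X"
  shows "0 \<le> sg X * (form X V V / form X G G - (form X G V / form X G G)\<^sup>2)"
proof -
  have pos: "form X G G > 0" using assms form_self_pos by auto
  obtain x y z u v w where G: "G = (x, y, z)" and V: "V = (u, v, w)" by (cases G; cases V) auto
  have "0 \<le> sg X * (form X G G * form X V V - (form X G V)\<^sup>2)"
  proof (cases X)
    case S2xR
    have "form X G G * form X V V - (form X G V)\<^sup>2
        = (x * v - y * u)\<^sup>2 + (x * w - z * u)\<^sup>2 + (y * w - z * v)\<^sup>2"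
      unfolding G V S2xR form_S2xR by algebra
    then show ?thesis by (simp add: S2xR)
  next
    case H2xR
    have x: "x > 0" "x\<^sup>2 - y\<^sup>2 - z\<^sup>2 > 0" using assms by (auto simp: G H2xR)
    \<comment> \<open>The Gram determinant of \<open>G\<close> and \<open>V\<close> is unchanged
      when multiples of \<open>G\<close> are added to \<open>V\<close>. Replacing \<open>V\<close>
      by \<open>x *\<^sub>R V - u *\<^sub>R G\<close>, whose first coordinate is 0, costs the factor
      \<open>x\<^sup>2\<close> and yields visibly nonnegative terms.\<close>
    have "x\<^sup>2 * (sg X * (form X G G * form X V V - (form X G V)\<^sup>2))
        = (x\<^sup>2 - y\<^sup>2 - z\<^sup>2) * ((x * v - y * u)\<^sup>2 + (x * w - z * u)\<^sup>2)
          + (y * (x * v - y * u) + z * (x * w - z * u))\<^sup>2"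
      unfolding G V H2xR form_H2xR sg.simps by algebra
    also have "\<dots> \<ge> 0" using x by simp
    finally show ?thesis using x(1) by (simp add: zero_le_mult_iff)
  qed
  also have "sg X * (form X G G * form X V V - (form X G V)\<^sup>2)
      = (form X G G)\<^sup>2 * (sg X * (form X V V / form X G G - (form X G V / form X G G)\<^sup>2))"
    using pos by (simp add: right_diff_distrib power2_eq_square)
  finally show ?thesis using pos by (simp add: zero_le_mult_iff)
qed

text \<open>The condition on \<open>k\<close> means \<open>k < 1\<close> for \<open>S2xR\<close> and
  \<open>k > 1\<close> for \<open>H2xR\<close>. By the last identity, scaling then keeps the
  radicand in the derivative of \<open>omega\<close> positive, even where the unscaled radicand
  vanishes.\<close>

lemma scaled_ratio_in_dom:
  assumes "y \<in> ratio_dom X" "0 < k" "sg X * (1 - k) > 0"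
  shows "k * y \<in> ratio_dom X" "sg X * (1 - y\<^sup>2) \<ge> 0" "sg X * (1 - k\<^sup>2) > 0"
    "sg X * (1 - (k * y)\<^sup>2) = k\<^sup>2 * (sg X * (1 - y\<^sup>2)) + sg X * (1 - k\<^sup>2)"
proof -
  show "sg X * (1 - (k * y)\<^sup>2) = k\<^sup>2 * (sg X * (1 - y\<^sup>2)) + sg X * (1 - k\<^sup>2)"
    by (simp add: right_diff_distrib power_mult_distrib mult.left_commute)
  have "1 - k\<^sup>2 = (1 - k) * (1 + k)"
    by (simp add: algebra_simps power2_eq_square)
  then show "sg X * (1 - k\<^sup>2) > 0"
    using mult_pos_pos[OF assms(3), of "1 + k"] assms(2) by (simp add: mult.assoc)
  show "sg X * (1 - y\<^sup>2) \<ge> 0"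
    using assms by (cases X) (auto simp: abs_square_le_1)
  show "k * y \<in> ratio_dom X"
  proof (cases X)
    case S2xR
    then have "\<bar>k * y\<bar> \<le> 1" using assms by (auto simp: abs_mult intro!: mult_le_one)
    then show ?thesis by (auto simp: S2xR)
  next
    case H2xR
    then have "1 * 1 \<le> k * y" using assms by (intro mult_mono) auto
    then show ?thesis by (simp add: H2xR)
  qed
qed

text \<open>The chain rule expresses \<open>w\<close> by the derivative of \<open>ratio\<close>, and
  \<open>ratio_derivative_bound\<close> limits its square by the orthogonal part of the line
  element. Adding the square of dt completes the line element.\<close>

lemma scaled_omega_derivative:
  fixes \<gamma> :: "real \<Rightarrow> point"
  assumes \<gamma>: "(\<gamma> has_vector_derivative V) (at \<tau>)" "P \<in> model X" "\<gamma> \<tau> \<in> model X"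
    and k: "0 < k" "sg X * (1 - k) > 0"
  obtains w where "((\<lambda>\<tau>. omega X (k * ratio X P (\<gamma> \<tau>))) has_real_derivative w) (at \<tau>)"
    "w\<^sup>2 + (form X (\<gamma> \<tau>) V / form X (\<gamma> \<tau>) (\<gamma> \<tau>))\<^sup>2 \<le> line_element X (\<gamma> \<tau>) V"
proof -
  define y where "y = ratio X P (\<gamma> \<tau>)"
  define y' where "y' = (form X (\<gamma> \<tau>) (\<gamma> \<tau>) * form X P V - form X P (\<gamma> \<tau>) * form X (\<gamma> \<tau>) V)
       / (form X (\<gamma> \<tau>) (\<gamma> \<tau>) * (sqrt (form X P P) * sqrt (form X (\<gamma> \<tau>) (\<gamma> \<tau>))))"
  define A where "A = sg X * (form X V V / form X (\<gamma> \<tau>) (\<gamma> \<tau>) - (form X (\<gamma> \<tau>) V / form X (\<gamma> \<tau>) (\<gamma> \<tau>))\<^sup>2)"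
  define q where "q = sg X * (1 - (k * y)\<^sup>2)"
  have y: "y \<in> ratio_dom X" unfolding y_def by (intro ratio_in_dom \<gamma>)
  note dom = scaled_ratio_in_dom[OF y k]
  \<comment> \<open>The first fact makes \<open>omega\<close> differentiable at
    \<open>k * y\<close>; the second lets \<open>q\<close> absorb the factor that bounds
    \<open>y'\<close>.\<close>
  have q: "q > 0" "k\<^sup>2 * (sg X * (1 - y\<^sup>2)) \<le> q"
    unfolding q_def dom(4) using dom(2,3) k by (auto intro: add_nonneg_pos)
  have A: "A \<ge> 0" unfolding A_def by (intro orthogonal_part_nonneg \<gamma>)
  have y': "y'\<^sup>2 \<le> (sg X * (1 - y\<^sup>2)) * A"
    unfolding y'_def y_def A_def by (intro ratio_derivative_bound \<gamma>)
  have dy: "((\<lambda>\<tau>. ratio X P (\<gamma> \<tau>)) has_real_derivative y') (at \<tau>)"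
    unfolding y'_def by (intro ratio_has_derivative \<gamma>)
  have d: "((\<lambda>\<tau>. omega X (k * ratio X P (\<gamma> \<tau>))) has_real_derivative (- sg X / sqrt q) * (k * y')) (at \<tau>)"
    unfolding q_def y_def
    by (rule DERIV_chain2[OF omega_has_derivative DERIV_cmult[OF dy]])
       (use dom(1) q(1) in \<open>simp_all only: q_def y_def\<close>)
  have "((- sg X / sqrt q) * (k * y'))\<^sup>2 = (sg X)\<^sup>2 * (k\<^sup>2 * y'\<^sup>2) / q"
    using q by (simp add: power_mult_distrib power_divide)
  also have "\<dots> = (k\<^sup>2 * y'\<^sup>2) / q" by (simp add: power2_eq_square)
  also have "\<dots> \<le> A"
  proof -
    have "k\<^sup>2 * y'\<^sup>2 \<le> k\<^sup>2 * (sg X * (1 - y\<^sup>2)) * A"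
      using mult_left_mono[OF y', of "k\<^sup>2"] by (simp add: mult.assoc)
    also have "\<dots> \<le> q * A" using q(2) A by (rule mult_right_mono)
    finally show ?thesis using q(1) by (simp add: divide_le_eq mult.commute)
  qed
  finally have "((- sg X / sqrt q) * (k * y'))\<^sup>2 \<le> A" .
  then show ?thesis
    by (intro that[OF d]) (simp add: line_element_form A_def)
qed

section \<open>Arc length and its lower bound by calibration\<close>

lemma line_element_nonneg: "P \<in> model X \<Longrightarrow> line_element X P V \<ge> 0"
  using orthogonal_part_nonneg[of P X V] by (simp add: line_element_form)

lemma speed_integrable:
  assumes "C1_curve X \<gamma> s u"
  shows "(\<lambda>\<tau>. sqrt (line_element X (\<gamma> \<tau>) (vector_derivative \<gamma> (at \<tau>)))) integrable_on {s..u}"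
proof -
  have m: "\<gamma> \<tau> \<in> model X" if "\<tau> \<in> {s..u}" for \<tau> using assms that by (auto simp: C1_curve_def)
  have d: "continuous_on {s..u} (\<lambda>\<tau>. vector_derivative \<gamma> (at \<tau>))"
    using assms by (auto simp: C1_curve_def C1_differentiable_on_eq)
  have c: "continuous_on {s..u} \<gamma>"
    using assms C1_differentiable_imp_continuous_on by (auto simp: C1_curve_def)
  have nz: "form X (\<gamma> \<tau>) (\<gamma> \<tau>) \<noteq> 0" if "\<tau> \<in> {s..u}" for \<tau> using form_self_pos[OF m[OF that]] by simp
  \<comment> \<open>Written with \<open>form\<close>, the line element is built from bilinear terms
    with nonvanishing denominators, so it inherits continuity from the curve and its
    derivative.\<close>
  have "continuous_on {s..u} (\<lambda>\<tau>. sqrt (line_element X (\<gamma> \<tau>) (vector_derivative \<gamma> (at \<tau>))))"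
    by (rule continuous_on_cong[THEN iffD2, OF refl arg_cong[where f = sqrt, OF line_element_form]])
       (auto intro!: continuous_intros form.continuous_on c d nz)
  then show ?thesis by (rule integrable_continuous_interval)
qed

lemma arc_length_nonneg:
  assumes "C1_curve X \<gamma> s u"
  shows "arc_length X \<gamma> s u \<ge> 0"
  unfolding arc_length_def
  using assms by (intro Henstock_Kurzweil_Integration.integral_nonneg speed_integrable)
    (auto simp: C1_curve_def intro!: line_element_nonneg)

text \<open>The calibrating function \<open>F\<close> has derivative
  \<open>\<alpha> * w + \<beta> * T\<close>. The planar Cauchy-Schwarz inequality and the gradient
  bound estimate it by the speed, and integration gives the claim.\<close>

lemma calibration_inequality:
  fixes \<alpha> \<beta> :: real
  assumes \<gamma>: "C1_curve X \<gamma> s u" and "s \<le> u" and P: "P \<in> model X"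
    and k: "0 < k" "sg X * (1 - k) > 0"
  shows "\<alpha> * (omega X (k * ratio X P (\<gamma> u)) - omega X (k * ratio X P (\<gamma> s)))
       + \<beta> * (ln (form X (\<gamma> u) (\<gamma> u) / form X (\<gamma> s) (\<gamma> s)) / 2)
    \<le> sqrt (\<alpha>\<^sup>2 + \<beta>\<^sup>2) * arc_length X \<gamma> s u"
proof -
  define F where "F \<tau> = \<alpha> * omega X (k * ratio X P (\<gamma> \<tau>)) + \<beta> * (ln (form X (\<gamma> \<tau>) (\<gamma> \<tau>)) / 2)" for \<tau>
  have m: "\<gamma> \<tau> \<in> model X" if "\<tau> \<in> {s..u}" for \<tau> using \<gamma> that by (auto simp: C1_curve_def)
  have "\<exists>f. (F has_real_derivative f) (at \<tau>) \<and>
      f \<le> sqrt (\<alpha>\<^sup>2 + \<beta>\<^sup>2) * sqrt (line_element X (\<gamma> \<tau>) (vector_derivative \<gamma> (at \<tau>)))"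
    if \<tau>: "\<tau> \<in> {s..u}" for \<tau>
  proof -
    define V where "V = vector_derivative \<gamma> (at \<tau>)"
    define T where "T = form X (\<gamma> \<tau>) V / form X (\<gamma> \<tau>) (\<gamma> \<tau>)"
    have V: "(\<gamma> has_vector_derivative V) (at \<tau>)"
      using \<gamma> \<tau> by (auto simp: C1_curve_def C1_differentiable_on_eq V_def vector_derivative_works[symmetric])
    obtain w where w: "((\<lambda>\<tau>. omega X (k * ratio X P (\<gamma> \<tau>))) has_real_derivative w) (at \<tau>)"
      "w\<^sup>2 + T\<^sup>2 \<le> line_element X (\<gamma> \<tau>) V"
      using scaled_omega_derivative[OF V P m[OF \<tau>] k] unfolding T_def by metis
    have "(F has_real_derivative (\<alpha> * w + \<beta> * T)) (at \<tau>)"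
      unfolding F_def T_def
      by (intro DERIV_add DERIV_cmult w ratio_has_derivative(2)[OF V P m[OF \<tau>]])
    moreover have "\<alpha> * w + \<beta> * T \<le> sqrt (\<alpha>\<^sup>2 + \<beta>\<^sup>2) * sqrt (line_element X (\<gamma> \<tau>) V)"
    proof -
      \<comment> \<open>Lagrange's identity in the plane.\<close>
      have "(\<alpha> * w + \<beta> * T)\<^sup>2 + (\<alpha> * T - \<beta> * w)\<^sup>2 = (\<alpha>\<^sup>2 + \<beta>\<^sup>2) * (w\<^sup>2 + T\<^sup>2)" by algebra
      then have "(\<alpha> * w + \<beta> * T)\<^sup>2 \<le> (\<alpha>\<^sup>2 + \<beta>\<^sup>2) * (w\<^sup>2 + T\<^sup>2)"
        by (smt (verit) zero_le_power2)
      also have "\<dots> \<le> (\<alpha>\<^sup>2 + \<beta>\<^sup>2) * line_element X (\<gamma> \<tau>) V"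
        using w(2) by (intro mult_left_mono) auto
      finally show ?thesis by (simp add: real_le_rsqrt flip: real_sqrt_mult)
    qed
    ultimately show ?thesis unfolding V_def by blast
  qed
  then obtain f where f: "\<And>\<tau>. \<tau> \<in> {s..u} \<Longrightarrow> (F has_real_derivative f \<tau>) (at \<tau>)"
    "\<And>\<tau>. \<tau> \<in> {s..u} \<Longrightarrow>
      f \<tau> \<le> sqrt (\<alpha>\<^sup>2 + \<beta>\<^sup>2) * sqrt (line_element X (\<gamma> \<tau>) (vector_derivative \<gamma> (at \<tau>)))"
    by metis
  have "(f has_integral F u - F s) {s..u}"
    using \<open>s \<le> u\<close> f(1)
    by (intro fundamental_theorem_of_calculus)
       (auto simp: has_real_derivative_iff_has_vector_derivative intro: has_vector_derivative_at_within)
  moreover have "((\<lambda>\<tau>. sqrt (\<alpha>\<^sup>2 + \<beta>\<^sup>2) * sqrt (line_element X (\<gamma> \<tau>) (vector_derivative \<gamma> (at \<tau>))))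
      has_integral sqrt (\<alpha>\<^sup>2 + \<beta>\<^sup>2) * arc_length X \<gamma> s u) {s..u}"
    unfolding arc_length_def
    by (intro has_integral_mult_right integrable_integral speed_integrable \<gamma>)
  ultimately have "F u - F s \<le> sqrt (\<alpha>\<^sup>2 + \<beta>\<^sup>2) * arc_length X \<gamma> s u"
    using f(2) by (rule has_integral_le)
  moreover have "form X (\<gamma> s) (\<gamma> s) > 0" "form X (\<gamma> u) (\<gamma> u) > 0"
    using m \<open>s \<le> u\<close> form_self_pos by auto
  ultimately show ?thesis
    by (simp add: F_def ln_div algebra_simps diff_divide_distrib)
qed

lemma ratio_self: "P \<in> model X \<Longrightarrow> ratio X P P = 1"
  using form_self_pos[of P X] by (simp add: ratio_def)

lemma ratio_commute: "ratio X P Q = ratio X Q P"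
  by (simp add: ratio_def form_commute mult.commute)

text \<open>In the calibration inequality the coefficients are taken to be the angle and the height
  difference of the end points themselves. As \<open>k\<close> tends to 1, the left side becomes the
  square of \<open>pdist\<close>, while the right side is \<open>pdist\<close> times the arc
  length.\<close>

lemma pdist_le_arc_length:
  assumes \<gamma>: "C1_curve X \<gamma> s u" and "s \<le> u"
  shows "pdist X (\<gamma> s) (\<gamma> u) \<le> arc_length X \<gamma> s u"
proof -
  define \<omega> where "\<omega> = omega X (ratio X (\<gamma> s) (\<gamma> u))"
  define \<beta> where "\<beta> = ln (form X (\<gamma> u) (\<gamma> u) / form X (\<gamma> s) (\<gamma> s)) / 2"
  \<comment> \<open>The denominators start at 2, so that \<open>k 0\<close> is 1/2 and not 0 for
    \<open>S2xR\<close>.\<close>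
  define k where "k n = 1 - sg X * inverse (real (Suc (Suc n)))" for n
  have m: "\<gamma> s \<in> model X" "\<gamma> u \<in> model X" using \<gamma> \<open>s \<le> u\<close> by (auto simp: C1_curve_def)
  have k: "0 < k n" "sg X * (1 - k n) > 0" for n
    by (cases X; simp add: k_def field_simps)+
  have klim: "k \<longlonglongrightarrow> 1"
    unfolding k_def
    using tendsto_diff[OF tendsto_const
      tendsto_mult[OF tendsto_const[of "sg X"] LIMSEQ_Suc[OF LIMSEQ_inverse_real_of_nat]], of 1]
    by simp
  have cont: "continuous_on (ratio_dom X) (omega X)"
    by (cases X) (auto intro!: continuous_intros continuous_on_arccos' continuous_on_arcosh')
  \<comment> \<open>Unlike its derivative, \<open>omega\<close> behaves well up to the boundary of
    \<open>ratio_dom\<close>: it is continuous there, and the scaled arguments stay inside.\<close>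
  have lim: "(\<lambda>n. omega X (k n * y)) \<longlonglongrightarrow> omega X y" if "y \<in> ratio_dom X" for y
    by (rule continuous_on_tendsto_compose[OF cont _ that])
       (use scaled_ratio_in_dom(1)[OF that k] in \<open>auto intro!: tendsto_eq_intros klim\<close>)
  have "(\<lambda>n. \<omega> * (omega X (k n * ratio X (\<gamma> s) (\<gamma> u)) - omega X (k n * ratio X (\<gamma> s) (\<gamma> s))) + \<beta> * \<beta>)
      \<longlonglongrightarrow> \<omega> * (\<omega> - omega X (ratio X (\<gamma> s) (\<gamma> s))) + \<beta> * \<beta>"
    unfolding \<omega>_def by (intro tendsto_intros lim ratio_in_dom m)
  then have "\<omega> * (\<omega> - omega X (ratio X (\<gamma> s) (\<gamma> s))) + \<beta> * \<beta> \<le> sqrt (\<omega>\<^sup>2 + \<beta>\<^sup>2) * arc_length X \<gamma> s u"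
    by (rule LIMSEQ_le_const2)
       (use calibration_inequality[OF \<gamma> \<open>s \<le> u\<close> m(1) k, where \<alpha> = \<omega> and \<beta> = \<beta>] in \<open>auto simp: \<beta>_def\<close>)
  moreover have "omega X (ratio X (\<gamma> s) (\<gamma> s)) = 0"
    using ratio_self[OF m(1)] by (cases X) simp_all
  ultimately have "(pdist X (\<gamma> s) (\<gamma> u))\<^sup>2 \<le> pdist X (\<gamma> s) (\<gamma> u) * arc_length X \<gamma> s u"
    by (simp add: pdist_def \<omega>_def \<beta>_def power2_eq_square)
  moreover have "pdist X (\<gamma> s) (\<gamma> u) \<ge> 0" by (simp add: pdist_def)
  \<comment> \<open>A positive \<open>pdist\<close> cancels; if it is 0, the claim is that arc
    length is nonnegative.\<close>
  ultimately show ?thesis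
    using arc_length_nonneg[OF \<gamma>] by (cases "pdist X (\<gamma> s) (\<gamma> u) = 0") (auto simp: power2_eq_square)
qed

section \<open>Great circles and a curve attaining the bound\<close>

lemma orthogonal_null_eq_0:
  assumes "P \<in> model X" "form X P V = 0" "form X V V = 0"
  shows "V = 0"
proof -
  obtain x y z u v w where P: "P = (x, y, z)" and V: "V = (u, v, w)" by (cases P; cases V) auto
  show ?thesis
  proof (cases X)
    case S2xR
    then have "u\<^sup>2 + (v\<^sup>2 + w\<^sup>2) = 0" using assms(3) by (simp add: V power2_eq_square)
    then have "u = 0" "v = 0" "w = 0" by (simp_all add: add_nonneg_eq_0_iff)
    then show ?thesis by (simp add: V zero_prod_def)
  next
    case H2xR
    have x: "x > 0" "x\<^sup>2 - y\<^sup>2 - z\<^sup>2 > 0" using assms(1) by (auto simp: P H2xR)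
    have e: "x * u - y * v - z * w = 0" "u * u - v * v - w * w = 0"
      using assms(2,3) unfolding P V H2xR form_H2xR by auto
    \<comment> \<open>Lagrange's identity for \<open>(y, z)\<close> and \<open>(v, w)\<close>,
      rewritten by \<open>e\<close>; both summands are nonnegative and so vanish.\<close>
    have "(x\<^sup>2 - y\<^sup>2 - z\<^sup>2) * u\<^sup>2 + (y * w - z * v)\<^sup>2 = 0"
      using e by algebra
    then have "(x\<^sup>2 - y\<^sup>2 - z\<^sup>2) * u\<^sup>2 = 0"
      using x(2) by (subst (asm) add_nonneg_eq_0_iff) auto
    then have u: "u = 0" using x(2) by simp
    then have "v\<^sup>2 + w\<^sup>2 = 0" using e(2) by algebra
    then show ?thesis using u by (simp add: V zero_prod_def)
  qed
qed

fun gcos :: "geometry \<Rightarrow> real \<Rightarrow> real" where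
  "gcos S2xR = cos"
| "gcos H2xR = cosh"

fun gsin :: "geometry \<Rightarrow> real \<Rightarrow> real" where
  "gsin S2xR = sin"
| "gsin H2xR = sinh"

lemma gcos_gsin_sq: "(gcos X x)\<^sup>2 + sg X * (gsin X x)\<^sup>2 = 1"
  by (cases X) (simp_all add: cosh_square_eq)

lemma gcos_diff: "gcos X (x - y) = gcos X x * gcos X y + sg X * (gsin X x * gsin X y)"
  by (cases X) (simp_all add: cos_diff cosh_diff)

lemma gcos_omega: "y \<in> ratio_dom X \<Longrightarrow> gcos X (omega X y) = y"
  by (cases X) (simp_all add: cosh_arcosh_real)

lemma omega_gcos:
  assumes "y \<in> ratio_dom X" "0 \<le> t" "t \<le> 1"
  shows "omega X (gcos X (t * omega X y)) = t * omega X y"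
proof (cases X)
  case S2xR
  then have "0 \<le> arccos y" "arccos y \<le> pi" using assms by (auto simp: arccos_lbound arccos_ubound)
  \<comment> \<open>A factor \<open>t\<close> between 0 and 1 keeps the angle in the interval from 0
    to \<open>pi\<close>, where arccos inverts cos.\<close>
  then have "0 \<le> t * arccos y" "t * arccos y \<le> 1 * pi"
    using assms by (simp, intro mult_mono) auto
  then show ?thesis by (simp add: S2xR arccos_cos)
next
  case H2xR
  then have "0 \<le> arcosh y" using assms by (simp add: arcosh_nonneg_real)
  then show ?thesis using assms by (simp add: H2xR arcosh_cosh_real)
qed

lemma gcos_derivative:
  "((\<lambda>\<tau>. gcos X (\<tau> * \<omega>)) has_vector_derivative - (sg X * gsin X (\<tau> * \<omega>) * \<omega>)) (at \<tau>)"
  by (cases X)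
    (auto intro!: derivative_eq_intros simp flip: has_real_derivative_iff_has_vector_derivative)

lemma gsin_derivative:
  "((\<lambda>\<tau>. gsin X (\<tau> * \<omega>)) has_vector_derivative gcos X (\<tau> * \<omega>) * \<omega>) (at \<tau>)"
  by (cases X)
    (auto intro!: derivative_eq_intros simp flip: has_real_derivative_iff_has_vector_derivative)

lemma continuous_on_gcos_gsin [continuous_intros]:
  fixes f :: "real \<Rightarrow> real"
  assumes "continuous_on A f"
  shows "continuous_on A (\<lambda>x. gcos X (f x))" "continuous_on A (\<lambda>x. gsin X (f x))"
  using assms by (cases X; auto intro!: continuous_intros)+

lemma scaleR_in_model:
  assumes "P \<in> model X" "r > 0"
  shows "r *\<^sub>R P \<in> model X"
proof (cases X)
  case S2xR
  then show ?thesis using assms by (cases P) auto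
next
  case H2xR
  obtain x y z where P: "P = (x, y, z)" by (cases P) auto
  have "(r * x)\<^sup>2 - (r * y)\<^sup>2 - (r * z)\<^sup>2 = r\<^sup>2 * (x\<^sup>2 - y\<^sup>2 - z\<^sup>2)"
    by (simp add: algebra_simps power_mult_distrib)
  moreover have "r\<^sup>2 * (x\<^sup>2 - y\<^sup>2 - z\<^sup>2) > 0" using assms by (simp add: P H2xR)
  ultimately have "(r * x)\<^sup>2 - (r * y)\<^sup>2 - (r * z)\<^sup>2 > 0" by (simp only:)
  then show ?thesis using assms by (simp add: P H2xR)
qed

text \<open>It supplies a direction for a great circle whose end points are proportional and so do
  not determine one.\<close>

lemma unit_orthogonal_exists:
  assumes "P \<in> model X"
  obtains W where "form X P W = 0" "form X W W = sg X"
proof -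
  obtain x y z where P: "P = (x, y, z)" by (cases P) auto
  have "\<exists>V. form X P V = 0 \<and> sg X * form X V V > 0"
  \<comment> \<open>The general witness \<open>(- sg X * y, x, 0)\<close> is orthogonal to
    \<open>P\<close> by construction. It degenerates only for \<open>x = 0\<close> and
    \<open>y = 0\<close>, which \<open>x > 0\<close> excludes for \<open>H2xR\<close>.\<close>
  proof (cases "X = S2xR \<and> x = 0 \<and> y = 0")
    case True
    then show ?thesis by (intro exI[of _ "(1, 0, 0)"]) (simp add: P)
  next
    case False
    have "sg X * y\<^sup>2 + x\<^sup>2 > 0"
    proof (cases X)
      case S2xR
      then show ?thesis using False by (auto simp: add_pos_nonneg add_nonneg_pos)
    next
      case H2xR
      then have "x\<^sup>2 - y\<^sup>2 - z\<^sup>2 > 0" using assms P by auto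
      then have "x\<^sup>2 - y\<^sup>2 > 0" using zero_le_power2[of z] by linarith
      then show ?thesis using H2xR by simp
    qed
    moreover have "sg X * form X (- sg X * y, x, 0) (- sg X * y, x, 0) = sg X * y\<^sup>2 + x\<^sup>2"
      by (cases X) (simp_all add: power2_eq_square)
    ultimately have "sg X * form X (- sg X * y, x, 0) (- sg X * y, x, 0) > 0" by (simp only:)
    then show ?thesis
      by (intro exI[of _ "(- sg X * y, x, 0)"]) (simp add: P)
  qed
  then obtain V where V: "form X P V = 0" "sg X * form X V V > 0" by blast
  define r where "r = sqrt (sg X * form X V V)"
  have r: "r > 0" "r * r = sg X * form X V V" using V(2) by (auto simp: r_def)
  have "sg X * (r * r) = form X V V" unfolding r(2) by (simp flip: mult.assoc)
  then have "form X ((1 / r) *\<^sub>R V) ((1 / r) *\<^sub>R V) = sg X"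
    using r(1) by (simp add: form.scaleR_left form.scaleR_right field_simps)
  moreover have "form X P ((1 / r) *\<^sub>R V) = 0" using V by (simp add: form.scaleR_right)
  ultimately show ?thesis using that by blast
qed

text \<open>A Gram-Schmidt step: \<open>V\<close>, the part of \<open>q\<close> orthogonal to
  \<open>p\<close>, has \<open>form X V V = sg X * (gsin X \<omega>)\<^sup>2\<close>, so dividing by
  \<open>gsin X \<omega>\<close> normalises it.\<close>

lemma initial_direction:
  assumes p: "p \<in> model X" "form X p p = 1" and q: "q \<in> model X" "form X q q = 1"
  defines "\<omega> \<equiv> omega X (form X p q)"
  obtains W where "form X p W = 0" "form X W W = sg X" "q = gcos X \<omega> *\<^sub>R p + gsin X \<omega> *\<^sub>R W"
proof -
  define r where "r = form X p q"
  have "ratio X p q = r" using p q by (simp add: ratio_def r_def)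
  then have c: "gcos X \<omega> = r"
    using ratio_in_dom[OF p(1) q(1)] by (simp add: \<omega>_def r_def[symmetric] gcos_omega)
  have s: "r\<^sup>2 + sg X * (gsin X \<omega>)\<^sup>2 = 1" using gcos_gsin_sq[of X \<omega>] by (simp add: c)
  define V where "V = q - r *\<^sub>R p"
  have V: "form X p V = 0"
    using p by (simp add: V_def r_def[symmetric] form.diff_right form.scaleR_right)
  have "form X V V = 1 - r\<^sup>2"
    using p q by (simp add: V_def form.diff_right form.diff_left form.scaleR_right form.scaleR_left
        r_def[symmetric] form_commute[of X q p] power2_eq_square)
  then have VV: "form X V V = sg X * (gsin X \<omega>)\<^sup>2" using s by simp
  show ?thesis
  proof (cases "gsin X \<omega> = 0")
    \<comment> \<open>Here \<open>V\<close> is null and orthogonal to \<open>p\<close>, hence 0 by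
      definiteness, and every unit direction serves as \<open>W\<close>.\<close>
    case True
    then have "V = 0" using orthogonal_null_eq_0[OF p(1) V] VV by simp
    then have "q = r *\<^sub>R p" by (simp add: V_def)
    moreover obtain W where "form X p W = 0" "form X W W = sg X" using unit_orthogonal_exists[OF p(1)] .
    ultimately show ?thesis using that True c by simp
  next
    case False
    have "form X p ((1 / gsin X \<omega>) *\<^sub>R V) = 0" using V by (simp add: form.scaleR_right)
    moreover have "form X ((1 / gsin X \<omega>) *\<^sub>R V) ((1 / gsin X \<omega>) *\<^sub>R V) = sg X"
      using False VV by (simp add: form.scaleR_right form.scaleR_left power2_eq_square)
    moreover have "q = gcos X \<omega> *\<^sub>R p + gsin X \<omega> *\<^sub>R ((1 / gsin X \<omega>) *\<^sub>R V)"
      using False by (simp add: c V_def)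
    ultimately show ?thesis using that by blast
  qed
qed

text \<open>The Pythagorean identity keeps the point on the unit sphere of \<open>form\<close>. For
  \<open>H2xR\<close> it must also lie on the sheet with positive first coordinate, which follows
  from comparing \<open>\<bar>sinh x\<bar>\<close> with \<open>cosh x\<close> and
  \<open>\<bar>w1\<bar>\<close> with \<open>p1\<close>.\<close>

lemma great_circle_in_model:
  assumes p: "p \<in> model X" "form X p p = 1" and W: "form X p W = 0" "form X W W = sg X"
  shows "gcos X x *\<^sub>R p + gsin X x *\<^sub>R W \<in> model X"
proof -
  define n where "n = gcos X x *\<^sub>R p + gsin X x *\<^sub>R W"
  have n: "form X n n = 1"
    using p W gcos_gsin_sq[of X x]
    by (simp add: n_def form.add_left form.add_right form.scaleR_left form.scaleR_right
        form_commute[of X W p] power2_eq_square mult_ac)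
  have "n \<in> model X"
  proof (cases X)
    case S2xR
    have "n \<noteq> 0" using n form.zero_left[of X n] by auto
    then show ?thesis by (cases n) (simp add: S2xR zero_prod_def)
  next
    case H2xR
    obtain p1 p2 p3 w1 w2 w3 where pW: "p = (p1, p2, p3)" "W = (w1, w2, w3)" by (cases p; cases W) auto
    have e: "p1 * p1 - p2 * p2 - p3 * p3 = 1" "p1 * w1 - p2 * w2 - p3 * w3 = 0"
      "w1 * w1 - w2 * w2 - w3 * w3 = - 1" and p1: "p1 > 0"
      using p W unfolding pW H2xR form_H2xR by auto
    \<comment> \<open>Lagrange's identity for the last two coordinates of \<open>p\<close> and
      \<open>W\<close>, rewritten by \<open>e\<close>.\<close>
    have "p1\<^sup>2 - w1\<^sup>2 = 1 + (p2 * w3 - p3 * w2)\<^sup>2" using e by algebra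
    then have "\<bar>w1\<bar>\<^sup>2 < p1\<^sup>2" using zero_le_power2[of "p2 * w3 - p3 * w2"] by (simp; linarith)
    then have w1: "\<bar>w1\<bar> < p1" using p1 by (simp add: power2_less_imp_less)
    have "\<bar>sinh x\<bar>\<^sup>2 < (cosh x)\<^sup>2" by (simp add: cosh_square_eq)
    then have sc: "\<bar>sinh x\<bar> < cosh x" by (rule power2_less_imp_less) simp
    have "\<bar>sinh x * w1\<bar> < cosh x * p1"
      unfolding abs_mult using sc w1 by (intro mult_strict_mono') auto
    then have "cosh x * p1 + sinh x * w1 > 0" by linarith
    moreover obtain y z where yz: "n = (cosh x * p1 + sinh x * w1, y, z)"
      by (simp add: n_def pW H2xR)
    ultimately show ?thesis
      using n unfolding yz H2xR form_H2xR by (simp add: power2_eq_square)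
  qed
  then show ?thesis by (simp add: n_def)
qed

text \<open>Constant speed makes the length of each subarc within the unit interval equal to
  \<open>pdist\<close> of its ends, which no competing curve undercuts. Thus every such subarc is
  minimal, and 1 can serve as the \<epsilon> of \<open>geodesic_curve\<close>.\<close>

lemma minimizing_geodesic_exists:
  assumes P: "P \<in> model X" and Q: "Q \<in> model X"
  obtains \<gamma> where "geodesic_curve X P Q \<gamma>" "arc_length X \<gamma> 0 1 = pdist X P Q"
proof -
  have NP: "form X P P > 0" and NQ: "form X Q Q > 0" using P Q form_self_pos by auto
  define m n where "m = sqrt (form X P P)" and "n = sqrt (form X Q Q)"
  have mn: "m > 0" "n > 0" "form X P P = m * m" "form X Q Q = n * n"
    using NP NQ by (auto simp: m_def n_def)
  define p q where "p = (1 / m) *\<^sub>R P" and "q = (1 / n) *\<^sub>R Q"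
  have p: "p \<in> model X" "form X p p = 1" and q: "q \<in> model X" "form X q q = 1"
    using mn scaleR_in_model[OF P, of "1 / m"] scaleR_in_model[OF Q, of "1 / n"]
    by (auto simp: p_def q_def form.scaleR_left form.scaleR_right)
  define \<omega> where "\<omega> = omega X (ratio X P Q)"
  define b where "b = ln (form X Q Q / form X P P) / 2"
  have r: "ratio X P Q = form X p q"
    by (simp add: ratio_def p_def q_def form.scaleR_left form.scaleR_right m_def n_def)
  obtain W where W: "form X p W = 0" "form X W W = sg X"
    and qW: "q = gcos X \<omega> *\<^sub>R p + gsin X \<omega> *\<^sub>R W"
    using initial_direction[OF p q] unfolding \<omega>_def r by metis
  have b: "m * exp b = n"
  proof -
    have "b = ln (n / m)"
      using mn(1,2) unfolding b_def mn(3,4) by (simp add: ln_div ln_mult)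
    then show ?thesis using mn(1,2) by simp
  qed
  \<comment> \<open>The logarithm of \<open>E\<close> grows linearly from that of \<open>m\<close>
    to that of \<open>n\<close>, while \<open>c\<close> runs from \<open>p\<close> to
    \<open>q\<close> along a great circle with angular speed \<open>\<omega>\<close>.\<close>
  define E where "E \<tau> = m * exp (\<tau> * b)" for \<tau>
  define c where "c \<tau> = gcos X (\<tau> * \<omega>) *\<^sub>R p + gsin X (\<tau> * \<omega>) *\<^sub>R W" for \<tau>
  define c' where "c' \<tau> = - (sg X * gsin X (\<tau> * \<omega>) * \<omega>) *\<^sub>R p + (gcos X (\<tau> * \<omega>) * \<omega>) *\<^sub>R W" for \<tau>
  define \<gamma> where "\<gamma> \<tau> = E \<tau> *\<^sub>R c \<tau>" for \<tau>
  define V where "V \<tau> = E \<tau> *\<^sub>R c' \<tau> + (b * E \<tau>) *\<^sub>R c \<tau>" for \<tau>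
  have E: "E \<tau> > 0" for \<tau> using mn by (simp add: E_def)
  note form_simps = form.add_left form.add_right form.diff_left form.diff_right
    form.scaleR_left form.scaleR_right form_commute[of X W p] p W
  have c: "c \<tau> \<in> model X" for \<tau> unfolding c_def by (rule great_circle_in_model[OF p W])
  have \<gamma>: "\<gamma> \<tau> \<in> model X" for \<tau> unfolding \<gamma>_def by (intro scaleR_in_model c E)
  \<comment> \<open>By the addition theorem. Equal parameters show that \<open>c\<close> has unit
    norm; different ones give the \<open>ratio\<close> of two points of the curve.\<close>
  have cc: "form X (c \<sigma>) (c \<tau>) = gcos X ((\<tau> - \<sigma>) * \<omega>)" for \<sigma> \<tau>
    by (simp add: c_def form_simps left_diff_distrib gcos_diff algebra_simps)
  have cc1: "form X (c \<tau>) (c \<tau>) = 1" for \<tau>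
    using cc[of \<tau> \<tau>] by (cases X) simp_all
  have cc': "form X (c \<tau>) (c' \<tau>) = 0" for \<tau>
    by (simp add: c_def c'_def form_simps algebra_simps)
  have c'c': "form X (c' \<tau>) (c' \<tau>) = sg X * \<omega>\<^sup>2" for \<tau>
  proof -
    have "form X (c' \<tau>) (c' \<tau>)
        = sg X * \<omega>\<^sup>2 * ((gcos X (\<tau> * \<omega>))\<^sup>2 + sg X * (gsin X (\<tau> * \<omega>))\<^sup>2)"
      by (simp add: c'_def form_simps power2_eq_square algebra_simps)
    then show ?thesis by (simp add: gcos_gsin_sq)
  qed
  have \<gamma>\<gamma>: "form X (\<gamma> \<tau>) (\<gamma> \<tau>) = (E \<tau>)\<^sup>2" for \<tau>
    by (simp add: \<gamma>_def form.scaleR_left form.scaleR_right cc1 power2_eq_square)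
  have dE: "(E has_real_derivative b * E \<tau>) (at \<tau>)" for \<tau>
    unfolding E_def by (auto intro!: derivative_eq_intros)
  have dc: "(c has_vector_derivative c' \<tau>) (at \<tau>)" for \<tau>
  proof -
    have "((\<lambda>\<tau>. gcos X (\<tau> * \<omega>) *\<^sub>R p + gsin X (\<tau> * \<omega>) *\<^sub>R W) has_vector_derivative
       (gcos X (\<tau> * \<omega>) *\<^sub>R 0 + - (sg X * gsin X (\<tau> * \<omega>) * \<omega>) *\<^sub>R p)
       + (gsin X (\<tau> * \<omega>) *\<^sub>R 0 + (gcos X (\<tau> * \<omega>) * \<omega>) *\<^sub>R W)) (at \<tau>)"
      by (intro has_vector_derivative_add has_vector_derivative_scaleR has_vector_derivative_const)
        (simp_all only: has_real_derivative_iff_has_vector_derivative gcos_derivative gsin_derivative)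
    then show ?thesis by (simp add: c_def[abs_def] c'_def)
  qed
  have dV: "(\<gamma> has_vector_derivative V \<tau>) (at \<tau>)" for \<tau>
    unfolding \<gamma>_def[abs_def] V_def by (rule has_vector_derivative_scaleR[OF dE dc])
  have C1: "C1_curve X \<gamma> s u" for s u
  proof -
    have "continuous_on {s..u} V"
      unfolding V_def[abs_def] E_def c_def c'_def by (intro continuous_intros)
    then have "\<gamma> C1_differentiable_on {s..u}"
      using dV unfolding C1_differentiable_on_def by blast
    then show ?thesis using \<gamma> by (auto simp: C1_curve_def)
  qed
  have speed: "line_element X (\<gamma> \<tau>) (V \<tau>) = \<omega>\<^sup>2 + b\<^sup>2" for \<tau>
  proof -
    have "form X (\<gamma> \<tau>) (V \<tau>) = b * (E \<tau>)\<^sup>2"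
      by (simp add: \<gamma>_def V_def form.add_right form.scaleR_left form.scaleR_right cc' cc1 power2_eq_square)
    moreover have "form X (V \<tau>) (V \<tau>) = (sg X * \<omega>\<^sup>2 + b\<^sup>2) * (E \<tau>)\<^sup>2"
      by (simp add: V_def form.add_left form.add_right form.scaleR_left form.scaleR_right cc' cc1 c'c'
          form_commute[of X "c' \<tau>" "c \<tau>"] power2_eq_square algebra_simps)
    ultimately show ?thesis
      using E[of \<tau>] by (simp add: line_element_form \<gamma>\<gamma> flip: mult.assoc)
  qed
  have len: "arc_length X \<gamma> s u = (u - s) * sqrt (\<omega>\<^sup>2 + b\<^sup>2)" if "s \<le> u" for s u
    using that by (simp add: arc_length_def vector_derivative_at[OF dV] speed)
  \<comment> \<open>The bound \<open>u - s \<le> 1\<close> is what \<open>omega_gcos\<close>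
    requires to recover the angle \<open>(u - s) * \<omega>\<close>.\<close>
  have dist: "pdist X (\<gamma> s) (\<gamma> u) = (u - s) * sqrt (\<omega>\<^sup>2 + b\<^sup>2)" if "s \<le> u" "u - s \<le> 1" for s u
  proof -
    have "ratio X (\<gamma> s) (\<gamma> u) = gcos X ((u - s) * \<omega>)"
      using E[of s] E[of u] unfolding ratio_def \<gamma>\<gamma>
      by (simp add: \<gamma>_def form.scaleR_left form.scaleR_right cc)
    then have "omega X (ratio X (\<gamma> s) (\<gamma> u)) = (u - s) * \<omega>"
      using that omega_gcos[OF ratio_in_dom[OF P Q], of "u - s"] by (simp add: \<omega>_def)
    moreover have "ln (form X (\<gamma> u) (\<gamma> u) / form X (\<gamma> s) (\<gamma> s)) / 2 = (u - s) * b"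
      using E[of s] E[of u] mn(1) unfolding \<gamma>\<gamma>
      by (simp add: ln_div ln_realpow) (simp add: E_def ln_mult algebra_simps)
    ultimately have "pdist X (\<gamma> s) (\<gamma> u) = sqrt ((u - s)\<^sup>2 * (\<omega>\<^sup>2 + b\<^sup>2))"
      by (simp add: pdist_def power_mult_distrib distrib_left)
    then show ?thesis using that by (simp add: real_sqrt_mult)
  qed
  have ends: "\<gamma> 0 = P" "\<gamma> 1 = Q"
  proof -
    have "c 0 = p" unfolding c_def by (cases X) simp_all
    then show "\<gamma> 0 = P" using mn by (simp add: \<gamma>_def E_def p_def)
    have "c 1 = q" by (simp add: c_def qW)
    then show "\<gamma> 1 = Q" using mn b by (simp add: \<gamma>_def E_def q_def)
  qed
  have "arc_length X \<gamma> s u \<le> arc_length X \<delta> s u"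
    if "0 \<le> s \<and> s < u \<and> u \<le> 1 \<and> u - s < 1" "C1_curve X \<delta> s u \<and> \<delta> s = \<gamma> s \<and> \<delta> u = \<gamma> u" for s u \<delta>
    using that pdist_le_arc_length[of X \<delta> s u] dist[of s u] len[of s u] by auto
  then have "geodesic_curve X P Q \<gamma>"
    unfolding geodesic_curve_def using C1 ends by (intro conjI exI[of _ 1]) auto
  moreover have "arc_length X \<gamma> 0 1 = pdist X P Q"
    using dist[of 0 1] len[of 0 1] ends by simp
  ultimately show ?thesis by (rule that)
qed

section \<open>The distance formula and the equation of the surface\<close>

lemma pdist_commute:
  assumes "P \<in> model X" "Q \<in> model X"
  shows "pdist X P Q = pdist X Q P"
proof -
  have "form X P P > 0" "form X Q Q > 0" using assms form_self_pos by auto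
  then have "ln (form X Q Q / form X P P) = - ln (form X P P / form X Q Q)"
    by (simp add: ln_div)
  then show ?thesis by (simp add: pdist_def ratio_commute[of X Q])
qed

text \<open>\<open>pdist_le_arc_length\<close> bounds the length of every admissible curve from
  below, and the constructed geodesic attains the bound, so the infimum is a minimum.\<close>

lemma geodesic_dist_eq_pdist:
  assumes "P \<in> model X" "Q \<in> model X"
  shows "geodesic_dist X P Q = pdist X P Q"
proof -
  obtain \<gamma> where \<gamma>: "geodesic_curve X P Q \<gamma>" "arc_length X \<gamma> 0 1 = pdist X P Q"
    using minimizing_geodesic_exists[OF assms] .
  show ?thesis
    unfolding geodesic_dist_def
  proof (rule cInf_eq_minimum)
    show "pdist X P Q \<in> {arc_length X \<gamma> 0 1 |\<gamma>. geodesic_curve X P Q \<gamma>}"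
      using \<gamma> by force
    show "pdist X P Q \<le> l" if "l \<in> {arc_length X \<gamma> 0 1 |\<gamma>. geodesic_curve X P Q \<gamma>}" for l
      using that pdist_le_arc_length[of X _ 0 1] by (auto simp: geodesic_curve_def)
  qed
qed

lemma four_geodesic_dist_sq:
  assumes "(a, b, c) \<in> model X" "(x, y, z) \<in> model X"
  shows "4 * (geodesic_dist X (a, b, c) (x, y, z))\<^sup>2
    = 4 * (omega X ((a * x \<plusminus>\<^bsub>X\<^esub> b * y \<plusminus>\<^bsub>X\<^esub> c * z) /
          (sqrt (a\<^sup>2 \<plusminus>\<^bsub>X\<^esub> b\<^sup>2 \<plusminus>\<^bsub>X\<^esub> c\<^sup>2) * sqrt (x\<^sup>2 \<plusminus>\<^bsub>X\<^esub> y\<^sup>2 \<plusminus>\<^bsub>X\<^esub> z\<^sup>2))))\<^sup>2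
        + (ln ((a\<^sup>2 \<plusminus>\<^bsub>X\<^esub> b\<^sup>2 \<plusminus>\<^bsub>X\<^esub> c\<^sup>2) / (x\<^sup>2 \<plusminus>\<^bsub>X\<^esub> y\<^sup>2 \<plusminus>\<^bsub>X\<^esub> z\<^sup>2)))\<^sup>2"
proof -
  have pm: "u * u' \<plusminus>\<^bsub>X\<^esub> v * v' \<plusminus>\<^bsub>X\<^esub> w * w' = form X (u, v, w) (u', v', w')" for u v w u' v' w'
    by (cases X) simp_all
  \<comment> \<open>Symmetry of \<open>pdist\<close> puts the first point into the numerator of the
    logarithm; the factor 4 cancels the square of the half in front of it.\<close>
  show ?thesis
    using pm[of a a b b c c] pm[of x x y y z z] pm[of a x b y c z]
    unfolding trans[OF geodesic_dist_eq_pdist pdist_commute, OF assms assms] pdist_def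
      ratio_commute[of X "(x, y, z)"]
    by (simp add: ratio_def power_divide flip: power2_eq_square del: form.simps)
qed

lemma geodesic_dist_nonneg:
  "P \<in> model X \<Longrightarrow> Q \<in> model X \<Longrightarrow> geodesic_dist X P Q \<ge> 0"
  by (simp add: geodesic_dist_eq_pdist pdist_def)

theorem theorem3p2:
  fixes X :: geometry and a b c d e f l :: real
  assumes "(a, b, c) \<in> model X" and "(d, e, f) \<in> model X" and "0 \<le> l"
  shows "\<forall>x y z. (x, y, z) \<in> model X \<longrightarrow>
    ((x, y, z) \<in> apollonius_surface X (a, b, c) (d, e, f) l \<longleftrightarrow>
      4 * (omega X ((a * x \<plusminus>\<^bsub>X\<^esub> b * y \<plusminus>\<^bsub>X\<^esub> c * z) /
          (sqrt (a\<^sup>2 \<plusminus>\<^bsub>X\<^esub> b\<^sup>2 \<plusminus>\<^bsub>X\<^esub> c\<^sup>2) * sqrt (x\<^sup>2 \<plusminus>\<^bsub>X\<^esub> y\<^sup>2 \<plusminus>\<^bsub>X\<^esub> z\<^sup>2))))\<^sup>2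
        + (ln ((a\<^sup>2 \<plusminus>\<^bsub>X\<^esub> b\<^sup>2 \<plusminus>\<^bsub>X\<^esub> c\<^sup>2) / (x\<^sup>2 \<plusminus>\<^bsub>X\<^esub> y\<^sup>2 \<plusminus>\<^bsub>X\<^esub> z\<^sup>2)))\<^sup>2
      = l\<^sup>2 *
       (4 * (omega X ((d * x \<plusminus>\<^bsub>X\<^esub> e * y \<plusminus>\<^bsub>X\<^esub> f * z) /
          (sqrt (d\<^sup>2 \<plusminus>\<^bsub>X\<^esub> e\<^sup>2 \<plusminus>\<^bsub>X\<^esub> f\<^sup>2) * sqrt (x\<^sup>2 \<plusminus>\<^bsub>X\<^esub> y\<^sup>2 \<plusminus>\<^bsub>X\<^esub> z\<^sup>2))))\<^sup>2
        + (ln ((d\<^sup>2 \<plusminus>\<^bsub>X\<^esub> e\<^sup>2 \<plusminus>\<^bsub>X\<^esub> f\<^sup>2) / (x\<^sup>2 \<plusminus>\<^bsub>X\<^esub> y\<^sup>2 \<plusminus>\<^bsub>X\<^esub> z\<^sup>2)))\<^sup>2))"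
proof (intro allI impI)
  fix x y z assume Q: "(x, y, z) \<in> model X"
  define D where "D = geodesic_dist X (a, b, c) (x, y, z)"
  define D' where "D' = geodesic_dist X (d, e, f) (x, y, z)"
  have D: "D \<ge> 0" "D' \<ge> 0" using assms Q by (auto simp: D_def D'_def geodesic_dist_nonneg)
  have "(x, y, z) \<in> apollonius_surface X (a, b, c) (d, e, f) l \<longleftrightarrow> D = l * D'"
    using Q assms pdist_commute[OF assms(2) Q]
    by (simp add: apollonius_surface_def D_def D'_def geodesic_dist_eq_pdist)
  \<comment> \<open>Squaring is reversible because \<open>0 \<le> l\<close> and both distances are
    nonnegative.\<close>
  also have "\<dots> \<longleftrightarrow> D\<^sup>2 = (l * D')\<^sup>2"
    using D assms(3) by (intro power2_eq_iff_nonneg[symmetric]) auto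
  also have "\<dots> \<longleftrightarrow> 4 * D\<^sup>2 = l\<^sup>2 * (4 * D'\<^sup>2)" by (simp add: power_mult_distrib)
  finally show "((x, y, z) \<in> apollonius_surface X (a, b, c) (d, e, f) l \<longleftrightarrow>
      4 * (omega X ((a * x \<plusminus>\<^bsub>X\<^esub> b * y \<plusminus>\<^bsub>X\<^esub> c * z) /
          (sqrt (a\<^sup>2 \<plusminus>\<^bsub>X\<^esub> b\<^sup>2 \<plusminus>\<^bsub>X\<^esub> c\<^sup>2) * sqrt (x\<^sup>2 \<plusminus>\<^bsub>X\<^esub> y\<^sup>2 \<plusminus>\<^bsub>X\<^esub> z\<^sup>2))))\<^sup>2
        + (ln ((a\<^sup>2 \<plusminus>\<^bsub>X\<^esub> b\<^sup>2 \<plusminus>\<^bsub>X\<^esub> c\<^sup>2) / (x\<^sup>2 \<plusminus>\<^bsub>X\<^esub> y\<^sup>2 \<plusminus>\<^bsub>X\<^esub> z\<^sup>2)))\<^sup>2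
      = l\<^sup>2 *
       (4 * (omega X ((d * x \<plusminus>\<^bsub>X\<^esub> e * y \<plusminus>\<^bsub>X\<^esub> f * z) /
          (sqrt (d\<^sup>2 \<plusminus>\<^bsub>X\<^esub> e\<^sup>2 \<plusminus>\<^bsub>X\<^esub> f\<^sup>2) * sqrt (x\<^sup>2 \<plusminus>\<^bsub>X\<^esub> y\<^sup>2 \<plusminus>\<^bsub>X\<^esub> z\<^sup>2))))\<^sup>2
        + (ln ((d\<^sup>2 \<plusminus>\<^bsub>X\<^esub> e\<^sup>2 \<plusminus>\<^bsub>X\<^esub> f\<^sup>2) / (x\<^sup>2 \<plusminus>\<^bsub>X\<^esub> y\<^sup>2 \<plusminus>\<^bsub>X\<^esub> z\<^sup>2)))\<^sup>2))"
    unfolding D_def D'_def four_geodesic_dist_sq[OF assms(1) Q] four_geodesic_dist_sq[OF assms(2) Q] .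
qed

end
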